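(* Let $n\ge 0$ be an integer and $0\le a\le 1$. One has an expansion (as polynomials in $u$) $$q_n(au)\,q_n((1-a)u)=\sum_{i=0}^{n}\beta_i^{(n)}(a)\,q_{n+i}(u),$$ whose coefficients are given, for $0\le i\le n$, by $$\beta_i^{(n)}(a)=(4a(1-a))^{i}\left(\frac{n!}{(2n)!}\right)^{2}2^{-2n}\,\frac{(2n-2i)!\,(2n+2i)!}{(n-i)!\,(n+i)!}\sum_{j=0}^{n-i}\binom{2n+1}{2j}\binom{n-j}{i}(2a-1)^{2j}.$$ In particular $\beta_i^{(n)}(a)\ge 0$ for all $0\le i\le n$.
   Context: For integers $n\ge0$, the (normalized) Bessel polynomial $q_n$ of degree $n$ is $$q_n(u)=\sum_{k=0}^{n}\alpha_k^{(n)}u^k,\qquad \alpha_k^{(n)}=\frac{n!\,(2n-k)!\,2^k}{(2n)!\,(n-k)!\,k!}.$$ Since $q_k$ has degree exactly $k$, expansions in the $q_k$ are unique. The convention $0^0=1$ is used. *)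

theory Defs
  imports Complex_Main "HOL-Computational_Algebra.Polynomial"
begin

definition bessel_coeff :: "nat \<Rightarrow> nat \<Rightarrow> real" where
  "bessel_coeff n k =
     (fact n * fact (2 * n - k) * 2 ^ k) / (fact (2 * n) * fact (n - k) * fact k)"

definition bessel_poly :: "nat \<Rightarrow> real poly" where
  "bessel_poly n = (\<Sum>k=0..n. monom (bessel_coeff n k) k)"

text \<open>Only used for \<^prop>\<open>i \<le> n\<close>, where none of the natural-number subtractions truncates.\<close>

definition beta_coeff :: "nat \<Rightarrow> nat \<Rightarrow> real \<Rightarrow> real" where
  "beta_coeff n i a =
     (4 * a * (1 - a)) ^ i * (fact n / fact (2 * n))\<^sup>2 * (1 / 2 ^ (2 * n)) *
     ((fact (2 * n - 2 * i) * fact (2 * n + 2 * i)) / (fact (n - i) * fact (n + i))) *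
     (\<Sum>j=0..n - i. real ((2 * n + 1) choose (2 * j)) * real ((n - j) choose i) *
        (2 * a - 1) ^ (2 * j))"

end

theory Submission
  imports Defs "HOL-Computational_Algebra.Polynomial_FPS"
begin

text \<open>
  The function \<open>k\<^sub>N(u) = exp (- u) q\<^sub>N(u)\<close> satisfies \<open>k\<^sub>N' = - u / (2 N - 1) k\<^bsub>N-1\<^esub>\<close> for \<open>N \<ge> 1\<close>, so up to degree
  \<open>2 N\<close> its power series is even with explicit coefficients. A polynomial \<open>R\<close> of degree at most
  \<open>2 n\<close> vanishes as soon as \<open>exp (- u) R(u)\<close> does up to degree \<open>2 n\<close>; hence it suffices to
  compare the coefficients of \<open>u ^ (2 l)\<close>, \<open>l \<le> n\<close>, after multiplying both sides by \<open>exp (- u)\<close>.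
  With \<open>z = (2 a - 1)\<^sup>2\<close>, each of the two turns out to be the same multiple of
  \<open>\<Sum>j\<le>l. binom(n, j) binom(n, l - j) z ^ j\<close>, which after expanding in powers of
  \<open>a\<^sup>2, (1 - a)\<^sup>2\<close> and of \<open>z\<close> respectively reduces to the Chu--Vandermonde identity.
\<close>

section \<open>Pochhammer symbols and an alternating Chu-Vandermonde sum\<close>

text \<open>Factorials of even numbers become Pochhammer symbols at 1/2, which turns the binomial
  sums below into terminating hypergeometric sums at argument 1.\<close>

abbreviation half_poch :: "nat \<Rightarrow> real" where
  "half_poch \<equiv> pochhammer (1 / 2)"

lemma half_poch_pos: "0 < half_poch m"
  by (simp add: pochhammer_pos)

lemma half_poch_neq_0 [simp]: "half_poch m \<noteq> 0"
  using half_poch_pos[of m] by simp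

lemma fact_double_half_poch: "fact (2 * m) = 4 ^ m * fact m * half_poch m"
  by (simp add: fact_double power_mult)

lemma fact_Suc_double_pochhammer:
  "fact (2 * m + 1) = 4 ^ m * fact m * pochhammer (3 / 2 :: real) m"
proof -
  have "half_poch (Suc m) = half_poch m * (1 / 2 + real m)"
    by (simp add: pochhammer_Suc)
  moreover have "half_poch (Suc m) = 1 / 2 * pochhammer (3 / 2) m"
    by (simp add: pochhammer_rec)
  ultimately have "pochhammer (3 / 2 :: real) m = half_poch m * (1 + 2 * real m)"
    by (simp add: field_simps)
  moreover have "fact (2 * m + 1) = (1 + 2 * real m) * fact (2 * m)"
    by simp
  ultimately show ?thesis
    unfolding fact_double_half_poch by simp
qed

text \<open>Chu-Vandermonde for 2F1(-r, x + m; y + p; 1): the factors \<open>pochhammer x m\<close>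
  and \<open>pochhammer y p\<close> split off from every term, and the signed binomial is (-r)_k /
  k!. Positivity of \<open>y\<close> keeps all denominators nonzero.\<close>

lemma alternating_pochhammer_sum:
  fixes x y :: real
  assumes "0 < y"
  shows "(\<Sum>k\<le>r. (-1) ^ k * real (r choose k) * pochhammer x (m + k) / pochhammer y (p + k)) =
    pochhammer x m * pochhammer (y + real p - x - real m) r / pochhammer y (p + r)"
proof -
  define u v where "u = x + real m" and "v = y + real p"
  have v: "0 < v" using assms by (simp add: v_def)
  have "pochhammer (- real r) k / fact k = (-1) ^ k * real (r choose k)" for k
    by (simp add: binomial_gbinomial gbinomial_pochhammer flip: power_mult_distrib mult.assoc)
  then have term_eq: "pochhammer u k * pochhammer (- real r) k / (fact k * pochhammer v k) =
      (-1) ^ k * real (r choose k) * pochhammer u k / pochhammer v k" for k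
    by (metis (no_types, lifting) mult.commute times_divide_eq_left divide_divide_eq_left)
  have "(\<Sum>k\<le>r. (-1) ^ k * real (r choose k) * pochhammer u k / pochhammer v k) =
      pochhammer (v - u) r / pochhammer v r"
    using Vandermonde_pochhammer[of r v u] v by (simp add: term_eq atMost_atLeast0)
  then have "pochhammer x m / pochhammer y p *
      (\<Sum>k\<le>r. (-1) ^ k * real (r choose k) * pochhammer u k / pochhammer v k) =
      pochhammer x m / pochhammer y p * (pochhammer (v - u) r / pochhammer v r)"
    by simp
  then show ?thesis
    by (simp add: u_def v_def sum_distrib_left pochhammer_product' diff_diff_eq mult.assoc mult.left_commute)
qed

section \<open>Bessel polynomials multiplied by exp (- u)\<close>

text \<open>For \<open>l\<close> <= \<open>N\<close> this is (-1)^l N! (2 (N - l))! / ((2 N)! (N -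
  l)! l!), which will be the coefficient of u^(2 l) in exp (- u) q_N(u).\<close>

definition even_coeff :: "nat \<Rightarrow> nat \<Rightarrow> real" where
  "even_coeff N l = (-1) ^ l * 4 ^ (N - l) * half_poch (N - l) * fact N / (fact l * fact (2 * N))"

text \<open>Up to a constant, the expansion of u^(N + 1/2) K_(N + 1/2)(u), where K is the modified
  Bessel function of the second kind.\<close>

definition bessel_exp :: "nat \<Rightarrow> real fps" where
  "bessel_exp N = fps_of_poly (bessel_poly N) * fps_exp (-1)"

lemma coeff_bessel_poly: "coeff (bessel_poly n) k = (if k \<le> n then bessel_coeff n k else 0)"
  by (simp add: bessel_poly_def coeff_sum sum.delta)

lemma degree_bessel_poly_le: "degree (bessel_poly n) \<le> n"
  by (simp add: coeff_bessel_poly degree_le)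

text \<open>The differential recursion for exp (- u) q_(n+1)(u) with the exponential stripped off,
  checked coefficient by coefficient. The boundary cases are the constant term, where the right-hand
  side vanishes, and the top degree, to which the derivative does not contribute.\<close>

lemma bessel_poly_deriv:
  "pderiv (bessel_poly (Suc n)) - bessel_poly (Suc n) =
     smult (- 1 / (2 * real n + 1)) (pCons 0 (bessel_poly n))"
proof (rule poly_eqI)
  fix k
  consider "k = 0" | j where "k = Suc j" "j < n" | "k = Suc n" | "k > Suc n"
    by (metis Suc_lessI less_Suc_eq_0_disj linorder_neqE_nat not_less_eq)
  then show "coeff (pderiv (bessel_poly (Suc n)) - bessel_poly (Suc n)) k =
     coeff (smult (- 1 / (2 * real n + 1)) (pCons 0 (bessel_poly n))) k"
  proof cases
    case 1
    then show ?thesis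
      by (simp add: coeff_pderiv coeff_bessel_poly bessel_coeff_def divide_simps)
  next
    case 2
    \<comment> \<open>The gap \<open>d\<close> = n - j - 1 makes every natural-number subtraction
      exact.\<close>
    obtain d where d: "n = Suc (j + d)" using 2 less_iff_Suc_add by auto
    have index: "2 * Suc n - Suc (Suc j) = 2 * n - j" "2 * Suc n - Suc j = Suc (2 * n - j)"
      "Suc n - Suc (Suc j) = d" "Suc n - Suc j = Suc d" "n - j = Suc d"
      by (auto simp: d)
    have "real (2 * n - j) = real j + 2 * real d + 2" "real n = real j + real d + 1"
      by (auto simp: d)
    moreover have "fact (2 * Suc n) = (2 * real n + 2) * (2 * real n + 1) * fact (2 * n)"
      by (simp add: algebra_simps)
    ultimately have "(real j + 2) * bessel_coeff (Suc n) (Suc (Suc j)) - bessel_coeff (Suc n) (Suc j) =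
        - 1 / (2 * real n + 1) * bessel_coeff n j"
      unfolding bessel_coeff_def index fact_Suc[of n] fact_Suc[of "2 * n - j"] fact_Suc[of d]
        fact_Suc[of j] fact_Suc[of "Suc j"]
      by (simp add: divide_simps del: mult_Suc_right fact_Suc) (simp add: algebra_simps)
    then show ?thesis
      using 2 by (simp add: coeff_pderiv coeff_bessel_poly algebra_simps)
  next
    case 3
    have "fact (2 * Suc n) = (2 * real n + 2) * (2 * real n + 1) * fact (2 * n)"
      by (simp add: algebra_simps)
    then have "bessel_coeff (Suc n) (Suc n) = 1 / (2 * real n + 1) * bessel_coeff n n"
      unfolding bessel_coeff_def
      by (simp add: divide_simps del: mult_Suc_right) (simp add: algebra_simps)
    with 3 show ?thesis
      by (simp add: coeff_pderiv coeff_bessel_poly)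
  next
    case 4
    then show ?thesis
      by (simp add: coeff_pderiv coeff_bessel_poly split: nat.splits)
        (auto simp: coeff_pCons coeff_bessel_poly split: nat.splits)
  qed
qed

lemma bessel_exp_deriv:
  "fps_deriv (bessel_exp (Suc n)) = fps_const (- 1 / (2 * real n + 1)) * (fps_X * bessel_exp n)"
proof -
  have "fps_deriv (bessel_exp (Suc n)) =
      fps_of_poly (pderiv (bessel_poly (Suc n)) - bessel_poly (Suc n)) * fps_exp (-1)"
    by (simp add: bessel_exp_def fps_of_poly_pderiv fps_of_poly_diff algebra_simps flip: fps_const_neg)
  then show ?thesis
    by (simp add: bessel_poly_deriv fps_of_poly_smult fps_of_poly_pCons bessel_exp_def mult_ac)
qed

text \<open>The derivative recursion lowers \<open>m\<close> by two and \<open>N\<close> by one, so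
  the bound \<open>m\<close> <= 2 \<open>N\<close> survives the induction. Past this bound odd
  coefficients do occur, since the recursion then reaches exp (- u) with its linear term.\<close>

lemma bessel_exp_nth:
  assumes "m \<le> 2 * N"
  shows "fps_nth (bessel_exp N) m = (if even m then even_coeff N (m div 2) else 0)"
  using assms
proof (induction m arbitrary: N rule: less_induct)
  case (less m)
  consider "m = 0" | n where "m = 1" "N = Suc n" | n m' where "m = Suc (Suc m')" "N = Suc n"
    using less.prems by (cases m; cases N; cases "m - 1") auto
  then show ?case
  proof cases
    case 1
    then show ?thesis
      by (simp add: bessel_exp_def even_coeff_def coeff_bessel_poly bessel_coeff_def fact_double_half_poch)
  next
    case 2
    \<comment> \<open>The derivative carries a factor \<open>fps_X\<close>, so the linear
      coefficient vanishes.\<close>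
    have "fps_nth (fps_deriv (bessel_exp N)) (0) = 0"
      by (simp add: 2 bessel_exp_deriv)
    then show ?thesis by (simp add: 2)
  next
    case 3
    have "fps_nth (fps_deriv (bessel_exp N)) (Suc m') = - 1 / (2 * real n + 1) * fps_nth (bessel_exp n) m'"
      by (simp add: 3 bessel_exp_deriv)
    then have eq: "fps_nth (bessel_exp N) m = - 1 / ((real m' + 2) * (2 * real n + 1)) * fps_nth (bessel_exp n) m'"
      unfolding 3 by (simp add: divide_simps) (simp add: algebra_simps)
    have IH: "fps_nth (bessel_exp n) m' = (if even m' then even_coeff n (m' div 2) else 0)"
      using less 3 by simp
    show ?thesis
    proof (cases "even m'")
      case True
      then obtain l where l: "m' = 2 * l" by blast
      have "fact (2 * Suc n) = (2 * real n + 2) * (2 * real n + 1) * fact (2 * n)"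
        by (simp add: algebra_simps)
      moreover have "fact (Suc n) = (real n + 1) * fact n" "fact (Suc l) = (real l + 1) * fact l"
        by (simp_all add: algebra_simps)
      ultimately have "even_coeff (Suc n) (Suc l) = - 1 / ((2 * real l + 2) * (2 * real n + 1)) * even_coeff n l"
        unfolding even_coeff_def by (simp del: fact_Suc mult_Suc_right add: divide_simps)
        (simp add: algebra_simps)
      then show ?thesis using eq IH l by (simp add: 3)
    next
      case False
      then show ?thesis using eq IH 3 by simp
    qed
  qed
qed

section \<open>The product side: powers of a^2 and (1 - a)^2\<close>

text \<open>The sum is the coefficient of p^j q^k t^(j+k) in ((1 + (p - q) t)^2 + 4 q t)^n, where
  \<open>m\<close> counts the factors 4 q t. Summed in reverse order it is a multiple of 2F1(-k, N +
  j + 1/2; 2 N + j + 1; 1) with N = n - j - k.\<close>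

lemma trinomial_coefficient:
  assumes "j + k \<le> n"
  shows "(\<Sum>m\<le>k. real (n choose m) * 4 ^ m * real ((2 * n - 2 * m) choose (j + k - m)) *
      real ((j + k - m) choose j) * (-1) ^ (k - m)) =
    4 ^ n * fact n * half_poch (n - j) * half_poch (n - k) /
      (fact j * fact k * fact (2 * n - (j + k)) * half_poch (n - (j + k)))"
proof -
  define N where "N = n - (j + k)"
  have n: "n = N + j + k" using assms by (simp add: N_def)
  let ?A = "4 ^ n * fact n / (fact j * fact k) :: real"
  \<comment> \<open>The (n - m)! contained in (2 n - 2 m)! cancels the one in the denominator of
    \<open>n choose m\<close>, leaving a single Pochhammer quotient in k - m.\<close>
  have term_eq: "real (n choose m) * 4 ^ m * real ((2 * n - 2 * m) choose (j + k - m)) *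
      real ((j + k - m) choose j) * (-1) ^ (k - m) =
      ?A * ((-1) ^ (k - m) * real (k choose (k - m)) * half_poch (N + j + (k - m)) /
        pochhammer 1 (2 * N + j + (k - m)))" if "m \<le> k" for m
  proof -
    obtain q where q: "k = m + q" using le_Suc_ex \<open>m \<le> k\<close> by blast
    have ix: "n = N + j + m + q" "2 * n - 2 * m = 2 * (N + j + q)" "j + k - m = j + q" "k - m = q"
      "n - m = N + j + q" "2 * (N + j + q) - (j + q) = 2 * N + j + q"
      by (simp_all add: n q)
    have 1: "real (n choose m) = fact n / (fact m * fact (N + j + q))"
      using binomial_fact[of m n, where 'a = real] by (simp add: ix add.assoc)
    have 2: "real (2 * (N + j + q) choose (j + q)) =
        4 ^ (N + j + q) * fact (N + j + q) * half_poch (N + j + q) / (fact (j + q) * fact (2 * N + j + q))"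
      using binomial_fact[of "j + q" "2 * (N + j + q)", where 'a = real] unfolding ix fact_double_half_poch by simp
    have 3: "real ((j + q) choose j) = fact (j + q) / (fact j * fact q)"
      using binomial_fact[of j "j + q", where 'a = real] by simp
    have 4: "real (k choose q) = fact k / (fact m * fact q)"
      using binomial_fact[of q k, where 'a = real] by (simp add: q mult.commute)
    have 5: "(4::real) ^ n = 4 ^ m * 4 ^ (N + j + q)"
      by (simp add: ix power_add)
    show ?thesis
      unfolding ix(2-5) 1 2 3 4 5 by (simp add: pochhammer_fact[symmetric] add_ac mult_ac)
  qed
  have "(\<Sum>m\<le>k. real (n choose m) * 4 ^ m * real ((2 * n - 2 * m) choose (j + k - m)) *
      real ((j + k - m) choose j) * (-1) ^ (k - m)) =
      ?A * (\<Sum>m\<le>k. (-1) ^ (k - m) * real (k choose (k - m)) * half_poch (N + j + (k - m)) /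
        pochhammer 1 (2 * N + j + (k - m)))"
    unfolding sum_distrib_left by (intro sum.cong refl term_eq) simp
  also have "(\<Sum>m\<le>k. (-1) ^ (k - m) * real (k choose (k - m)) * half_poch (N + j + (k - m)) /
        pochhammer 1 (2 * N + j + (k - m))) =
      (\<Sum>q\<le>k. (-1) ^ q * real (k choose q) * half_poch (N + j + q) / pochhammer 1 (2 * N + j + q))"
    using sum.nat_diff_reindex[of "\<lambda>q. (-1) ^ q * real (k choose q) * half_poch (N + j + q) /
        pochhammer 1 (2 * N + j + q)" "Suc k"]
    by (simp only: lessThan_Suc_atMost diff_Suc_Suc)
  \<comment> \<open>Here x = 1/2 and y = 1, so the parameter on the right is 1 + (2 N + j) - 1/2 -
    (N + j) = 1/2 + N.\<close>
  also have "\<dots> = half_poch (N + j) * pochhammer (1 / 2 + real N) k / fact (2 * N + j + k)"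
    by (subst alternating_pochhammer_sum) (simp_all add: pochhammer_fact[symmetric] add.commute)
  also have "pochhammer (1 / 2 + real N) k = half_poch (N + k) / half_poch N"
    using half_poch_pos[of N] by (simp add: pochhammer_product')
  finally show ?thesis
    by (simp add: n add_ac mult_ac)
qed

lemma fps_nth_one_plus_linear_power:
  fixes c :: real
  shows "fps_nth ((1 + fps_const c * fps_X) ^ n) k = real (n choose k) * c ^ k"
proof (induction n arbitrary: k)
  case 0
  show ?case by (cases k) simp_all
next
  case (Suc n)
  have "(1 + fps_const c * fps_X) ^ Suc n =
      (1 + fps_const c * fps_X) ^ n + fps_const c * (fps_X * (1 + fps_const c * fps_X) ^ n)"
    by (simp add: distrib_right mult.assoc)
  then show ?case
    by (cases k) (simp_all only: fps_add_nth fps_mult_left_const_nth fps_X_mult_nth Suc, simp_all add: algebra_simps)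
qed

text \<open>Both sides are the coefficient of \<open>t ^ l\<close> in
  \<open>((1 + (a - b)\<^sup>2 t) (1 + (a + b)\<^sup>2 t)) ^ n = ((1 + (a\<^sup>2 - b\<^sup>2) t)\<^sup>2 + 4 b\<^sup>2 t) ^ n\<close>.\<close>

lemma square_trinomial_expansion:
  fixes a b :: real
  assumes "l \<le> n"
  shows "(\<Sum>j\<le>l. real (n choose j) * real (n choose (l - j)) *
      ((a - b)\<^sup>2) ^ j * ((a + b)\<^sup>2) ^ (l - j)) =
    4 ^ n * fact n / (fact (2 * n - l) * half_poch (n - l)) *
    (\<Sum>j\<le>l. half_poch (n - j) * half_poch (n - (l - j)) / (fact j * fact (l - j)) *
      (a\<^sup>2) ^ j * (b\<^sup>2) ^ (l - j))"
proof -
  define p q where "p = a\<^sup>2" and "q = b\<^sup>2"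
  define B where "B m = real (n choose m) * 4 ^ m * real ((2 * n - 2 * m) choose (l - m))" for m
  define T where "T m j = B m * real ((l - m) choose j) * (-1) ^ (l - j - m)" for m j
  let ?L = "\<lambda>c :: real. 1 + fps_const c * fps_X"
  have "?L ((a - b)\<^sup>2) * ?L ((a + b)\<^sup>2) = (?L (p - q))\<^sup>2 + fps_const (4 * q) * fps_X"
  proof -
    have 1: "((a - b)\<^sup>2) * ((a + b)\<^sup>2) = (p - q)\<^sup>2" "(a - b)\<^sup>2 + (a + b)\<^sup>2 = 2 * (p - q) + 4 * q"
      by (simp_all add: p_def q_def power2_eq_square algebra_simps)
    have "?L ((a - b)\<^sup>2) * ?L ((a + b)\<^sup>2) =
        1 + fps_const ((a - b)\<^sup>2 + (a + b)\<^sup>2) * fps_X + fps_const (((a - b)\<^sup>2) * ((a + b)\<^sup>2)) * fps_X\<^sup>2"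
      by (simp add: distrib_left distrib_right power2_eq_square mult_ac add_ac flip: fps_const_add fps_const_mult)
    also have "\<dots> = 1 + (fps_const (p - q) + fps_const (p - q) + fps_const (4 * q)) * fps_X +
        fps_const (p - q) * fps_const (p - q) * fps_X\<^sup>2"
      unfolding 1 by (simp add: power2_eq_square)
    also have "\<dots> = (?L (p - q))\<^sup>2 + fps_const (4 * q) * fps_X"
      by (simp only: power2_eq_square distrib_left distrib_right mult_1_left mult_1_right mult_ac add_ac)
    finally show ?thesis .
  qed
  then have eq: "?L ((a - b)\<^sup>2) ^ n * ?L ((a + b)\<^sup>2) ^ n = (fps_const (4 * q) * fps_X + (?L (p - q))\<^sup>2) ^ n"
    by (simp add: add.commute flip: power_mult_distrib)
  have "(\<Sum>j\<le>l. real (n choose j) * real (n choose (l - j)) *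
      ((a - b)\<^sup>2) ^ j * ((a + b)\<^sup>2) ^ (l - j)) = fps_nth (?L ((a - b)\<^sup>2) ^ n * ?L ((a + b)\<^sup>2) ^ n) l"
    by (simp add: fps_mult_nth fps_nth_one_plus_linear_power atMost_atLeast0 mult.assoc mult.left_commute)
  also have "\<dots> = (\<Sum>m\<le>n. fps_nth
      (of_nat (n choose m) * (fps_const (4 * q) * fps_X) ^ m * ((?L (p - q))\<^sup>2) ^ (n - m)) l)"
    unfolding eq by (simp only: binomial_ring fps_sum_nth)
  also have "\<dots> = (\<Sum>m\<le>n. if m \<le> l then B m * q ^ m * (p - q) ^ (l - m) else 0)"
  proof (rule sum.cong)
    fix m
    \<comment> \<open>The factor t^m shifts the index, so what remains to be read off is the
      coefficient of t^(l - m) in (1 + (p - q) t)^(2 n - 2 m).\<close>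
    have "of_nat (n choose m) * (fps_const (4 * q) * fps_X) ^ m * ((?L (p - q))\<^sup>2) ^ (n - m) =
        fps_const (real (n choose m) * (4 * q) ^ m) * (fps_X ^ m * ?L (p - q) ^ (2 * n - 2 * m))"
      by (simp add: power_mult_distrib fps_const_power fps_of_nat mult.assoc right_diff_distrib'
          flip: power_mult fps_const_mult)
    then show "fps_nth
        (of_nat (n choose m) * (fps_const (4 * q) * fps_X) ^ m * ((?L (p - q))\<^sup>2) ^ (n - m)) l =
      (if m \<le> l then B m * q ^ m * (p - q) ^ (l - m) else 0)"
      by (simp only: fps_mult_left_const_nth fps_X_power_mult_nth fps_nth_one_plus_linear_power)
        (auto simp: B_def power_mult_distrib)
  qed simp
  also have "\<dots> = (\<Sum>m\<le>l. B m * q ^ m * (p - q) ^ (l - m))"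
    using assms by (intro sum.mono_neutral_cong_right) auto
  \<comment> \<open>Expanding (p - q)^(l - m) and padding the inner range with zeros makes the index
    set a square, so that the two sums can be swapped and the coefficient of p^j q^(l - j)
    isolated.\<close>
  also have "\<dots> = (\<Sum>m\<le>l. \<Sum>j\<le>l. if j \<le> l - m then T m j * (p ^ j * q ^ (l - j)) else 0)"
  proof (rule sum.cong)
    fix m assume m: "m \<in> {..l}"
    have expand: "(p - q) ^ (l - m) =
        (\<Sum>j\<le>l - m. real ((l - m) choose j) * p ^ j * (- q) ^ (l - m - j))"
      using binomial_ring[of p "- q" "l - m"] by simp
    have "B m * q ^ m * (p - q) ^ (l - m) = (\<Sum>j\<le>l - m. T m j * (p ^ j * q ^ (l - j)))"
      unfolding expand sum_distrib_left
    proof (rule sum.cong)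
      fix j assume "j \<in> {..l - m}"
      then have "q ^ (l - j) = q ^ m * q ^ (l - m - j)"
        using m by (simp flip: power_add)
      then show "B m * q ^ m * (real ((l - m) choose j) * p ^ j * (- q) ^ (l - m - j)) =
          T m j * (p ^ j * q ^ (l - j))"
        by (simp add: T_def power_minus[of q] add.commute)
    qed simp
    also have "\<dots> = (\<Sum>j\<le>l. if j \<le> l - m then T m j * (p ^ j * q ^ (l - j)) else 0)"
      by (intro sum.mono_neutral_cong_left) auto
    finally show "B m * q ^ m * (p - q) ^ (l - m) =
      (\<Sum>j\<le>l. if j \<le> l - m then T m j * (p ^ j * q ^ (l - j)) else 0)" .
  qed simp
  also have "\<dots> = (\<Sum>j\<le>l. \<Sum>m\<le>l. if j \<le> l - m then T m j * (p ^ j * q ^ (l - j)) else 0)"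
    by (rule sum.swap)
  also have "\<dots> = (\<Sum>j\<le>l. 4 ^ n * fact n / (fact (2 * n - l) * half_poch (n - l)) *
      (half_poch (n - j) * half_poch (n - (l - j)) / (fact j * fact (l - j)) * p ^ j * q ^ (l - j)))"
  proof (rule sum.cong)
    fix j assume j: "j \<in> {..l}"
    have "(\<Sum>m\<le>l. if j \<le> l - m then T m j * (p ^ j * q ^ (l - j)) else 0) =
        (\<Sum>m\<le>l - j. T m j * (p ^ j * q ^ (l - j)))"
      using j by (intro sum.mono_neutral_cong_right) auto
    also have "\<dots> = (\<Sum>m\<le>l - j. T m j) * (p ^ j * q ^ (l - j))"
      by (simp add: sum_distrib_right)
    also have "\<dots> = 4 ^ n * fact n / (fact (2 * n - l) * half_poch (n - l)) *
      (half_poch (n - j) * half_poch (n - (l - j)) / (fact j * fact (l - j)) * p ^ j * q ^ (l - j))"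
      using trinomial_coefficient[of j "l - j" n] j assms by (simp add: T_def B_def mult_ac)
    finally show "(\<Sum>m\<le>l. if j \<le> l - m then T m j * (p ^ j * q ^ (l - j)) else 0) =
      4 ^ n * fact n / (fact (2 * n - l) * half_poch (n - l)) *
      (half_poch (n - j) * half_poch (n - (l - j)) / (fact j * fact (l - j)) * p ^ j * q ^ (l - j))" .
  qed simp
  finally show ?thesis
    by (simp add: p_def q_def sum_distrib_left)
qed

section \<open>The beta side: powers of z = (2 a - 1)^2\<close>

text \<open>This sum arises as the coefficient of z^r in \<open>beta_sum_identity\<close>, up to a
  factor independent of \<open>j\<close>. Reversed, it is a multiple of 2F1(-r, n - l + 1/2; n - r +
  3/2; 1), whose value contains (l - r + 1)_r; this symbol is l! / (l - r)! for r <= l and zero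
  otherwise.\<close>

lemma double_binomial_coefficient:
  assumes "r \<le> n" "l \<le> n"
  shows "(\<Sum>j\<le>r. (-1) ^ (r - j) * real ((2 * n + 1) choose (2 * j)) *
      real ((n - j) choose (r - j)) *
      half_poch j * half_poch (n - l + (r - j))) =
    (if r \<le> l then fact l * fact (n - l + r) / fact n * half_poch (n - l) * real (n choose r) *
      real (n choose (l - r)) else 0)"
proof -
  define A :: real where "A = fact (2 * n + 1) / (4 ^ n * fact (n - r) * fact r)"
  \<comment> \<open>The even factorial (2 j)! absorbs \<open>half_poch j\<close>, and the odd
    factorial (2 n + 1 - 2 j)! supplies the denominator \<open>pochhammer (3 / 2)\<close>.\<close>
  have term_eq: "(-1) ^ (r - j) * real ((2 * n + 1) choose (2 * j)) * real ((n - j) choose (r - j)) *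
      half_poch j * half_poch (n - l + (r - j)) =
      A * ((-1) ^ (r - j) * real (r choose (r - j)) * half_poch (n - l + (r - j)) /
        pochhammer (3 / 2) (n - r + (r - j)))" if "j \<le> r" for j
  proof -
    have "j \<le> n" using that assms by simp
    then obtain m where m: "n = j + m" using le_Suc_ex by blast
    have ix: "n - j = m" "n - r + (r - j) = m" "m - (r - j) = n - r" "r - (r - j) = j" "2 * n + 1 - 2 * j = 2 * m + 1"
      using that assms by (auto simp: m)
    have 1: "real ((2 * n + 1) choose (2 * j)) =
       fact (2 * n + 1) / (4 ^ j * fact j * half_poch j * (4 ^ m * fact m * pochhammer (3 / 2) m))"
      using binomial_fact[of "2 * j" "2 * n + 1", where 'a = real] m
      unfolding ix fact_double_half_poch[of j] fact_Suc_double_pochhammer[of m]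
          by simp
    have 2: "real ((n - j) choose (r - j)) = fact m / (fact (r - j) * fact (n - r))"
      using binomial_fact[of "r - j" m, where 'a = real] assms by (simp add: ix m)
    have 3: "real (r choose (r - j)) = fact r / (fact (r - j) * fact j)"
      using binomial_fact[of "r - j" r, where 'a = real] that by simp
    have 4: "(4::real) ^ n = 4 ^ j * 4 ^ m" by (simp add: m power_add)
    show ?thesis
      unfolding 1 2 3 A_def 4 ix(2) by (simp add: mult_ac)
  qed
  have "(\<Sum>j\<le>r. (-1) ^ (r - j) * real ((2 * n + 1) choose (2 * j)) *
      real ((n - j) choose (r - j)) *
      half_poch j * half_poch (n - l + (r - j))) =
      A * (\<Sum>j\<le>r. (-1) ^ (r - j) * real (r choose (r - j)) * half_poch (n - l + (r - j)) /
        pochhammer (3 / 2) (n - r + (r - j)))"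
    unfolding sum_distrib_left by (intro sum.cong refl term_eq) simp
  also have "(\<Sum>j\<le>r. (-1) ^ (r - j) * real (r choose (r - j)) * half_poch (n - l + (r - j)) /
        pochhammer (3 / 2) (n - r + (r - j))) =
      (\<Sum>j\<le>r. (-1) ^ j * real (r choose j) * half_poch (n - l + j) / pochhammer (3 / 2) (n - r + j))"
    using sum.nat_diff_reindex[of "\<lambda>j. (-1) ^ j * real (r choose j) * half_poch (n - l + j) /
        pochhammer (3 / 2) (n - r + j)" "Suc r"]
    by (simp only: lessThan_Suc_atMost diff_Suc_Suc)
  also have "\<dots> = half_poch (n - l) * pochhammer (real l - real r + 1) r / pochhammer (3 / 2) n"
    using assms by (subst alternating_pochhammer_sum) (simp_all add: of_nat_diff algebra_simps)
  finally have main: "(\<Sum>j\<le>r. (-1) ^ (r - j) * real ((2 * n + 1) choose (2 * j)) *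
      real ((n - j) choose (r - j)) *
      half_poch j * half_poch (n - l + (r - j))) = 
      A * (half_poch (n - l) * pochhammer (real l - real r + 1) r / pochhammer (3 / 2) n)" .
  have A: "A = fact n * pochhammer (3 / 2) n / (fact (n - r) * fact r)"
    unfolding A_def fact_Suc_double_pochhammer by simp
  have P: "pochhammer (3 / 2 :: real) n > 0" by (simp add: pochhammer_pos)
  show ?thesis
  proof (cases "r \<le> l")
    case True
    have "fact (l - r + r) = fact (l - r) * pochhammer (1 + real (l - r)) r"
      by (simp only: pochhammer_fact pochhammer_product')
    then have "pochhammer (real l - real r + 1) r = fact l / fact (l - r)"
      using True by (simp add: of_nat_diff add.commute field_simps)
    then show ?thesis
      unfolding main A using True assms P
      by (simp add: binomial_fact Nat.diff_diff_right mult_ac)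
  next
    case False
    \<comment> \<open>The base is a nonpositive integer of absolute value below r, so one of the r
      factors is zero.\<close>
    then have "real l - real r + 1 = - real (r - Suc l)"
      by (simp add: of_nat_diff)
    moreover have "pochhammer (- real (r - Suc l)) r = 0"
      using False by (simp only: pochhammer_of_nat_eq_0_iff)
    ultimately have Z: "pochhammer (real l - real r + 1) r = 0"
      by (simp only:)
    show ?thesis
      unfolding main Z using False by simp
  qed
qed

text \<open>Expanding (1 - z)^i and collecting (-z)^q leaves, for each q, a Vandermonde convolution
  of two rising factorials. Their bases contain 1/2 each and add up to an integer, so the result is
  a quotient of factorials.\<close>

lemma half_poch_binomial_expansion:
  assumes "j \<le> n" "l \<le> n"
  shows "(\<Sum>i\<le>n. half_poch (n - i) * half_poch (n - l + i) * real ((n - j) choose i) * (1 - z) ^ i) =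
    (\<Sum>q\<le>n - j. (- z) ^ q * real ((n - j) choose q) * half_poch j * half_poch (n - l + q) *
      (fact (2 * n - l) / fact (n - l + j + q)))"
proof -
  define F where "F i = half_poch (n - i) * half_poch (n - l + i) * real ((n - j) choose i)" for i
  have z: "(1 - z) ^ i = (\<Sum>q\<le>n - j. real (i choose q) * (- z) ^ q)" if "i \<le> n - j" for i
  proof -
    have "(1 - z) ^ i = (\<Sum>q\<le>i. real (i choose q) * (- z) ^ q)"
      using binomial_ring[of "- z" 1 i] by simp
    also have "\<dots> = (\<Sum>q\<le>n - j. real (i choose q) * (- z) ^ q)"
      using that by (intro sum.mono_neutral_left) auto
    finally show ?thesis .
  qed
  have "(\<Sum>i\<le>n. F i * (1 - z) ^ i) =
      (\<Sum>i\<le>n - j. F i * (1 - z) ^ i)"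
    by (intro sum.mono_neutral_right) (auto simp: F_def)
  also have "\<dots> = (\<Sum>i\<le>n - j. \<Sum>q\<le>n - j. F i * (real (i choose q) * (- z) ^ q))"
    by (intro sum.cong refl) (simp add: z sum_distrib_left)
  also have "\<dots> = (\<Sum>q\<le>n - j. \<Sum>i\<le>n - j. F i * (real (i choose q) * (- z) ^ q))"
    by (rule sum.swap)
  also have "\<dots> = (\<Sum>q\<le>n - j. (- z) ^ q * real ((n - j) choose q) * half_poch j * half_poch (n - l + q) *
      (fact (2 * n - l) / fact (n - l + j + q)))"
  proof (rule sum.cong)
    fix q assume q: "q \<in> {..n - j}"
    define M where "M = n - j - q"
    have n: "n - j = q + M" "n = j + q + M" using q assms by (auto simp: M_def)
    have "(\<Sum>i\<le>n - j. F i * (real (i choose q) * (- z) ^ q)) =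
       (\<Sum>i\<in>{q..q + M}. F i * (real (i choose q) * (- z) ^ q))"
      unfolding n(1) by (intro sum.mono_neutral_right) auto
    also have "\<dots> = (\<Sum>p\<le>M. F (p + q) * (real ((p + q) choose q) * (- z) ^ q))"
      using sum.shift_bounds_cl_nat_ivl[of "\<lambda>i. F i * (real (i choose q) * (- z) ^ q)" 0 q M]
      by (simp add: atMost_atLeast0 add.commute)
    also have "\<dots> = (\<Sum>p\<le>M. (- z) ^ q * real ((n - j) choose q) * half_poch j * half_poch (n - l + q) *
        (real (M choose p) * pochhammer (1 / 2 + real (n - l + q)) p * pochhammer (1 / 2 + real j) (M - p)))"
    proof (rule sum.cong)
      fix p assume p: "p \<in> {..M}"
      \<comment> \<open>Choosing a subset of a subset: with i = p + q the binomials split into one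
        free of p and \<open>M choose p\<close>.\<close>
      have "((n - j) choose (p + q)) * ((p + q) choose q) = ((n - j) choose q) * (M choose p)"
        using choose_mult[of q "p + q" "n - j"] p n by simp
      then have "real ((n - j) choose (p + q)) * real ((p + q) choose q) = real ((n - j) choose q) * real (M choose p)"
        by (metis of_nat_mult)
      moreover have "half_poch (n - (p + q)) = half_poch j * pochhammer (1 / 2 + real j) (M - p)"
        using p by (simp add: n(2) flip: pochhammer_product')
      moreover have "half_poch (n - l + (p + q)) = half_poch (n - l + q) * pochhammer (1 / 2 + real (n - l + q)) p"
        using pochhammer_product'[of "1 / 2 :: real" "n - l + q" p] by (simp add: add_ac)
      ultimately show "F (p + q) * (real ((p + q) choose q) * (- z) ^ q) =
         (- z) ^ q * real ((n - j) choose q) * half_poch j * half_poch (n - l + q) *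
        (real (M choose p) * pochhammer (1 / 2 + real (n - l + q)) p * pochhammer (1 / 2 + real j) (M - p))"
        by (simp add: F_def)
    qed simp
    also have "\<dots> = (- z) ^ q * real ((n - j) choose q) * half_poch j * half_poch (n - l + q) *
        pochhammer ((1 / 2 + real (n - l + q)) + (1 / 2 + real j)) M"
      by (simp only: pochhammer_binomial_sum sum_distrib_left)
    also have "pochhammer ((1 / 2 + real (n - l + q)) + (1 / 2 + real j)) M = pochhammer (1 + real (n - l + j + q)) M"
      by (simp add: algebra_simps)
    also have "\<dots> = fact (2 * n - l) / fact (n - l + j + q)"
    proof -
      have "fact (n - l + j + q + M) = fact (n - l + j + q) * pochhammer (1 + real (n - l + j + q)) M"
        by (simp only: pochhammer_fact pochhammer_product')
      moreover have "n - l + j + q + M = 2 * n - l" using n(2) assms by simp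
      ultimately show ?thesis by simp
    qed
    finally show "(\<Sum>i\<le>n - j. F i * (real (i choose q) * (- z) ^ q)) =
       (- z) ^ q * real ((n - j) choose q) * half_poch j * half_poch (n - l + q) *
        (fact (2 * n - l) / fact (n - l + j + q))" .
  qed simp
  finally show ?thesis
    by (simp only: F_def)
qed

text \<open>Both sides are compared as polynomials in \<open>z\<close>:
  \<open>half_poch_binomial_expansion\<close> carries out the sum over i, and
  \<open>double_binomial_coefficient\<close> then evaluates the remaining sum for each power of
  z.\<close>

lemma beta_sum_identity:
  fixes z :: real
  assumes l: "l \<le> n"
  shows "(\<Sum>i\<le>n. half_poch (n - i) * half_poch (n - l + i) * (1 - z) ^ i *
      (\<Sum>j\<le>n - i. real ((2 * n + 1) choose (2 * j)) * real ((n - j) choose i) * z ^ j)) =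
    fact l / fact n * half_poch (n - l) * fact (2 * n - l) *
      (\<Sum>j\<le>l. real (n choose j) * real (n choose (l - j)) * z ^ j)"
proof -
  define c where "c j = real ((2 * n + 1) choose (2 * j))" for j
  define g where "g j q = c j * z ^ j * ((- z) ^ q * real ((n - j) choose q) * half_poch j *
    half_poch (n - l + q) * (fact (2 * n - l) / fact (n - l + j + q)))" for j q
  have "(\<Sum>i\<le>n. half_poch (n - i) * half_poch (n - l + i) * (1 - z) ^ i *
      (\<Sum>j\<le>n - i. c j * real ((n - j) choose i) * z ^ j)) =
    (\<Sum>i\<le>n. \<Sum>j\<le>n. c j * z ^ j *
      (half_poch (n - i) * half_poch (n - l + i) * real ((n - j) choose i) * (1 - z) ^ i))"
  proof (rule sum.cong)
    fix i assume "i \<in> {..n}"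
    \<comment> \<open>For j > n - i the binomial \<open>(n - j) choose i\<close> is zero, so the
      inner range can be made independent of i.\<close>
    then have "(\<Sum>j\<le>n - i. c j * real ((n - j) choose i) * z ^ j) =
        (\<Sum>j\<le>n. c j * real ((n - j) choose i) * z ^ j)"
      by (intro sum.mono_neutral_left) auto
    then show "half_poch (n - i) * half_poch (n - l + i) * (1 - z) ^ i *
        (\<Sum>j\<le>n - i. c j * real ((n - j) choose i) * z ^ j) =
      (\<Sum>j\<le>n. c j * z ^ j *
        (half_poch (n - i) * half_poch (n - l + i) * real ((n - j) choose i) * (1 - z) ^ i))"
      by (simp add: sum_distrib_left mult_ac)
  qed simp
  also have "\<dots> = (\<Sum>j\<le>n. c j * z ^ j *
      (\<Sum>i\<le>n. half_poch (n - i) * half_poch (n - l + i) * real ((n - j) choose i) * (1 - z) ^ i))"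
    by (subst sum.swap) (simp add: sum_distrib_left)
  also have "\<dots> = (\<Sum>j\<le>n. \<Sum>q\<le>n - j. g j q)"
    unfolding g_def sum_distrib_left[symmetric]
    by (intro sum.cong refl arg_cong2[where f = "(*)"] half_poch_binomial_expansion l) simp
  also have "\<dots> = (\<Sum>(j, q)\<in>{(j, q). j + q \<le> n}. g j q)"
    by (subst sum.Sigma) (auto intro!: sum.cong)
  \<comment> \<open>The terms are grouped by the total exponent r = j + q of z.\<close>
  also have "\<dots> = (\<Sum>r\<le>n. \<Sum>j\<le>r. g j (r - j))"
    by (rule sum.triangle_reindex_eq)
  also have "\<dots> = (\<Sum>r\<le>n. if r \<le> l then fact l / fact n * half_poch (n - l) * fact (2 * n - l) *
      (real (n choose r) * real (n choose (l - r)) * z ^ r) else 0)"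
  proof (rule sum.cong)
    fix r assume r: "r \<in> {..n}"
    have "(\<Sum>j\<le>r. g j (r - j)) = z ^ r * (fact (2 * n - l) / fact (n - l + r)) *
        (\<Sum>j\<le>r. (-1) ^ (r - j) * real ((2 * n + 1) choose (2 * j)) *
          real ((n - j) choose (r - j)) * half_poch j * half_poch (n - l + (r - j)))"
      unfolding sum_distrib_left
    proof (rule sum.cong)
      fix j assume "j \<in> {..r}"
      then have "z ^ j * (- z) ^ (r - j) = (-1) ^ (r - j) * z ^ r"
        by (simp add: power_minus[of z] flip: power_add)
      moreover have "n - l + j + (r - j) = n - l + r"
        using \<open>j \<in> {..r}\<close> by simp
      ultimately show "g j (r - j) = z ^ r * (fact (2 * n - l) / fact (n - l + r)) *
          ((-1) ^ (r - j) * real ((2 * n + 1) choose (2 * j)) *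
          real ((n - j) choose (r - j)) * half_poch j * half_poch (n - l + (r - j)))"
        unfolding g_def c_def by (simp add: mult_ac)
    qed simp
    then show "(\<Sum>j\<le>r. g j (r - j)) =
        (if r \<le> l then fact l / fact n * half_poch (n - l) * fact (2 * n - l) *
          (real (n choose r) * real (n choose (l - r)) * z ^ r) else 0)"
      using r double_binomial_coefficient[of r n l] l by (simp only: atMost_iff) (simp split: if_splits)
  qed simp
  also have "\<dots> = (\<Sum>r\<le>l. fact l / fact n * half_poch (n - l) * fact (2 * n - l) *
      (real (n choose r) * real (n choose (l - r)) * z ^ r))"
    using l by (intro sum.mono_neutral_cong_right) auto
  finally show ?thesis
    by (simp add: c_def sum_distrib_left)
qed

section \<open>Equality of the even coefficients\<close>

text \<open>These are the coefficients of u^(2 l) in exp (- u) times the two sides of the expansion.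
  The link is 1 - z = 4 a (1 - a), which turns the prefactor of \<open>beta_coeff\<close> into (1 -
  z)^i.\<close>

lemma even_coeff_linearization:
  assumes l: "l \<le> n"
  shows "(\<Sum>j\<le>l. a ^ (2 * j) * even_coeff n j * ((1 - a) ^ (2 * (l - j)) * even_coeff n (l - j))) =
    (\<Sum>i\<le>n. beta_coeff n i a * even_coeff (n + i) l)"
proof -
  define z where "z = (2 * a - 1)\<^sup>2"
  have z: "1 - z = 4 * a * (1 - a)"
    by (simp add: z_def power2_eq_square algebra_simps)
  define C :: real where "C = (-1) ^ l * (fact n / fact (2 * n))\<^sup>2"
  have "a ^ (2 * j) * even_coeff n j * ((1 - a) ^ (2 * (l - j)) * even_coeff n (l - j)) =
      C * 4 ^ (2 * n - l) * (half_poch (n - j) * half_poch (n - (l - j)) / (fact j * fact (l - j)) *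
        (a\<^sup>2) ^ j * ((1 - a)\<^sup>2) ^ (l - j))" if "j \<le> l" for j
  proof -
    have "(-1 :: real) ^ l = (-1) ^ j * (-1) ^ (l - j)"
      using that by (simp flip: power_add)
    moreover have "(4 :: real) ^ (2 * n - l) = 4 ^ (n - j) * 4 ^ (n - (l - j))"
      using that l by (simp flip: power_add)
    ultimately show ?thesis
      unfolding even_coeff_def C_def by (simp add: power_mult power_divide mult_ac)
        (simp add: power2_eq_square power_mult_distrib)
  qed
  then have "(\<Sum>j\<le>l. a ^ (2 * j) * even_coeff n j * ((1 - a) ^ (2 * (l - j)) * even_coeff n (l - j))) =
      C * 4 ^ (2 * n - l) * (\<Sum>j\<le>l. half_poch (n - j) * half_poch (n - (l - j)) / (fact j * fact (l - j)) *
        (a\<^sup>2) ^ j * ((1 - a)\<^sup>2) ^ (l - j))"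
    by (simp add: sum_distrib_left)
  \<comment> \<open>\<open>square_trinomial_expansion\<close> is read from right to left with b = 1
    - a: then (a - b)^2 = z and (a + b)^2 = 1, so only powers of z remain.\<close>
  also have "\<dots> = C * 4 ^ (n - l) / fact l * (fact l / fact n * half_poch (n - l) * fact (2 * n - l) *
      (\<Sum>j\<le>l. real (n choose j) * real (n choose (l - j)) * z ^ j))"
  proof -
    have "4 ^ (2 * n - l) = (4 :: real) ^ n * 4 ^ (n - l)"
      using l by (simp flip: power_add)
    then show ?thesis
      using square_trinomial_expansion[OF l, of a "1 - a"] by (simp add: z_def)
  qed
  also have "\<dots> = C * 4 ^ (n - l) / fact l *
      (\<Sum>i\<le>n. half_poch (n - i) * half_poch (n - l + i) * (1 - z) ^ i *
        (\<Sum>j\<le>n - i. real ((2 * n + 1) choose (2 * j)) * real ((n - j) choose i) * z ^ j))"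
    by (simp only: beta_sum_identity[OF l])
  also have "\<dots> = (\<Sum>i\<le>n. beta_coeff n i a * even_coeff (n + i) l)"
    unfolding sum_distrib_left[of "C * 4 ^ (n - l) / fact l"]
  proof (rule sum.cong)
    fix i assume "i \<in> {..n}"
    then have i: "i \<le> n" by simp
    have 1: "fact (2 * n - 2 * i) = 4 ^ (n - i) * fact (n - i) * half_poch (n - i)"
      using fact_double_half_poch[of "n - i"] by (simp add: diff_mult_distrib2)
    have 2: "n + i - l = n - l + i" "2 * n + 2 * i = 2 * (n + i)"
      using l by simp_all
    \<comment> \<open>The factor 4^(n - i) from (2 n - 2 i)! and 4^(n - l + i) from
      \<open>even_coeff\<close>, divided by 2^(2 n), leave a power of 4 free of i.\<close>
    have "4 ^ (n - l) * (2::real) ^ (2 * n) = 4 ^ (n - i) * 4 ^ (n - l + i)"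
      using i by (simp add: power_mult flip: power_add)
    then have 3: "(4::real) ^ (n - i) * 4 ^ (n - l + i) / 2 ^ (2 * n) = 4 ^ (n - l)"
      by (simp add: field_simps)
    have 4: "(2 * a - 1) ^ (2 * j) = z ^ j" for j
      by (simp add: z_def power_mult)
    define h where "h = (\<Sum>j\<le>n - i. real ((2 * n + 1) choose (2 * j)) * real ((n - j) choose i) * z ^ j)"
    have "beta_coeff n i a = (1 - z) ^ i * (fact n / fact (2 * n))\<^sup>2 * (1 / 2 ^ (2 * n)) *
        (4 ^ (n - i) * half_poch (n - i) * fact (2 * (n + i)) / fact (n + i)) * h"
      unfolding beta_coeff_def 1 2 z[symmetric] 4 h_def by (simp add: atMost_atLeast0)
    then have "beta_coeff n i a * even_coeff (n + i) l =
        C * ((4::real) ^ (n - i) * 4 ^ (n - l + i) / 2 ^ (2 * n)) / fact l *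
        (half_poch (n - i) * half_poch (n - l + i) * (1 - z) ^ i * h)"
      unfolding even_coeff_def 2 C_def by (simp add: mult_ac)
    then show "C * 4 ^ (n - l) / fact l * (half_poch (n - i) * half_poch (n - l + i) * (1 - z) ^ i *
        (\<Sum>j\<le>n - i. real ((2 * n + 1) choose (2 * j)) * real ((n - j) choose i) * z ^ j)) =
        beta_coeff n i a * even_coeff (n + i) l"
      unfolding 3 h_def by simp
  qed simp
  finally show ?thesis .
qed

section \<open>From truncated power series back to polynomials\<close>

text \<open>Multiplying back by exp u recovers \<open>R\<close>, and a coefficient of degree k <= d
  of this product involves only coefficients of degree at most k of the vanishing series.\<close>

lemma poly_eq_0_if_exp_mult_nth_eq_0:
  fixes R :: "real poly"
  assumes "degree R \<le> d" "\<And>m. m \<le> d \<Longrightarrow> fps_nth (fps_of_poly R * fps_exp (-1)) m = 0"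
  shows "R = 0"
proof (rule poly_eqI)
  fix k
  show "coeff R k = coeff 0 k"
  proof (cases "k \<le> d")
    case True
    have "fps_of_poly R = fps_of_poly R * fps_exp (-1) * fps_exp 1"
      using fps_exp_add_mult[of "-1 :: real" 1] by (simp add: mult.assoc)
    then have "coeff R k = fps_nth (fps_of_poly R * fps_exp (-1) * fps_exp 1) k"
      by (metis fps_of_poly_nth)
    also have "\<dots> = 0"
      unfolding fps_mult_nth[of "fps_of_poly R * fps_exp (-1)"]
      by (intro sum.neutral ballI) (use True assms(2) in simp)
    finally show ?thesis by simp
  next
    case False
    then show ?thesis using assms(1) by (simp add: coeff_eq_0)
  qed
qed

text \<open>Since exp (- u) = exp (- a u) exp (- (1 - a) u), the series is the product of
  \<open>bessel_exp n\<close> rescaled by a and by 1 - a; the sum is the Cauchy product.\<close>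

lemma bessel_product_exp_nth:
  "fps_nth (fps_of_poly (pcompose (bessel_poly n) [:0, a:] * pcompose (bessel_poly n) [:0, 1 - a:]) *
     fps_exp (-1)) m =
   (\<Sum>k=0..m. (a ^ k * fps_nth (bessel_exp n) k) * ((1 - a) ^ (m - k) * fps_nth (bessel_exp n) (m - k)))"
proof -
  have scale: "fps_of_poly (pcompose (bessel_poly n) [:0, c:]) * fps_exp (- c) =
      fps_compose (bessel_exp n) (fps_const c * fps_X)" for c
    by (simp add: bessel_exp_def fps_of_poly_pcompose fps_compose_mult_distrib fps_of_poly_pCons mult.commute[of fps_X])
  have "fps_exp (- 1 :: real) = fps_exp (- a) * fps_exp (- (1 - a))"
    by (simp flip: fps_exp_add_mult)
  then have "fps_of_poly (pcompose (bessel_poly n) [:0, a:] * pcompose (bessel_poly n) [:0, 1 - a:]) *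
     fps_exp (-1) = fps_compose (bessel_exp n) (fps_const a * fps_X) *
     fps_compose (bessel_exp n) (fps_const (1 - a) * fps_X)"
    unfolding scale[symmetric] by (simp only: fps_of_poly_mult mult_ac)
  then show ?thesis
    by (simp only: fps_mult_nth fps_nth_compose_linear)
qed

lemma beta_coeff_nonneg:
  assumes "0 \<le> a" "a \<le> 1"
  shows "0 \<le> beta_coeff n i a"
  using assms unfolding beta_coeff_def
  by (intro mult_nonneg_nonneg sum_nonneg zero_le_power zero_le_even_power) auto

theorem theorem2p2:
  fixes n :: nat and a :: real
  assumes "0 \<le> a" and "a \<le> 1"
  shows "pcompose (bessel_poly n) [:0, a:] * pcompose (bessel_poly n) [:0, 1 - a:] =
           (\<Sum>i=0..n. smult (beta_coeff n i a) (bessel_poly (n + i))) \<and>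
         (\<forall>i\<le>n. 0 \<le> beta_coeff n i a)"
proof
  let ?P = "pcompose (bessel_poly n) [:0, a:] * pcompose (bessel_poly n) [:0, 1 - a:]"
  let ?Q = "\<Sum>i=0..n. smult (beta_coeff n i a) (bessel_poly (n + i))"
  have "?P - ?Q = 0"
  proof (rule poly_eq_0_if_exp_mult_nth_eq_0)
    have "degree (pcompose (bessel_poly n) [:0, c:]) \<le> n" for c
      using degree_pcompose_le[of "bessel_poly n" "[:0, c:]"] degree_bessel_poly_le[of n]
      by (auto simp: degree_pCons_eq_if split: if_splits intro: order_trans)
    then have "degree ?P \<le> 2 * n"
      using degree_mult_le[of "pcompose (bessel_poly n) [:0, a:]" "pcompose (bessel_poly n) [:0, 1 - a:]"]
      by (smt (verit, best) add_mono le_trans mult_2)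
    moreover have "degree ?Q \<le> 2 * n"
      by (intro degree_sum_le) (use degree_bessel_poly_le in \<open>auto intro!: order_trans[OF degree_smult_le]
          order_trans[OF degree_bessel_poly_le]\<close>)
    ultimately show "degree (?P - ?Q) \<le> 2 * n"
      by (rule degree_diff_le)
  next
    fix m assume m: "m \<le> 2 * n"
    have "fps_of_poly ?Q * fps_exp (-1) = (\<Sum>i=0..n. fps_const (beta_coeff n i a) * bessel_exp (n + i))"
      by (simp add: fps_of_poly_sum fps_of_poly_smult bessel_exp_def sum_distrib_right mult.assoc)
    then have Q: "fps_nth (fps_of_poly ?Q * fps_exp (-1)) m =
        (\<Sum>i\<le>n. beta_coeff n i a * fps_nth (bessel_exp (n + i)) m)"
      by (simp add: fps_sum_nth atMost_atLeast0)
    have nth: "fps_nth (bessel_exp (n + i)) m = (if even m then even_coeff (n + i) (m div 2) else 0)" for i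
      using m by (intro bessel_exp_nth) simp
    have nth': "fps_nth (bessel_exp n) k = (if even k then even_coeff n (k div 2) else 0)" if "k \<le> m" for k
      using m that by (intro bessel_exp_nth) simp
    have "fps_nth (fps_of_poly ?P * fps_exp (-1)) m = fps_nth (fps_of_poly ?Q * fps_exp (-1)) m"
    proof (cases "even m")
      case False
      \<comment> \<open>For odd m one of k and m - k is odd, so each term of the Cauchy product has
        a zero factor.\<close>
      have "fps_nth (fps_of_poly ?P * fps_exp (-1)) m = 0"
        unfolding bessel_product_exp_nth using False by (intro sum.neutral) (auto simp: nth')
      then show ?thesis using False by (simp add: Q nth)
    next
      case True
      then obtain l where l: "m = 2 * l" by blast
      let ?f = "\<lambda>k. (a ^ k * fps_nth (bessel_exp n) k) * ((1 - a) ^ (m - k) * fps_nth (bessel_exp n) (m - k))"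
      \<comment> \<open>Only even k contribute, and they are the doubles of 0, ..., l.\<close>
      have "(\<Sum>k=0..m. ?f k) = (\<Sum>k\<in>(\<lambda>j. 2 * j) ` {..l}. ?f k)"
        by (intro sum.mono_neutral_right) (auto simp: l nth' elim!: evenE)
      also have "\<dots> = (\<Sum>j\<le>l. ?f (2 * j))"
        by (simp add: sum.reindex inj_on_def)
      also have "\<dots> = (\<Sum>j\<le>l. a ^ (2 * j) * even_coeff n j * ((1 - a) ^ (2 * (l - j)) * even_coeff n (l - j)))"
        by (intro sum.cong refl) (simp add: nth' l flip: right_diff_distrib')
      also have "\<dots> = (\<Sum>i\<le>n. beta_coeff n i a * even_coeff (n + i) l)"
        using m l by (intro even_coeff_linearization) simp
      finally show ?thesis
        unfolding bessel_product_exp_nth Q nth by (simp add: l)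
    qed
    then show "fps_nth (fps_of_poly (?P - ?Q) * fps_exp (-1)) m = 0"
      by (simp only: fps_of_poly_diff left_diff_distrib fps_sub_nth)
  qed
  then show "?P = ?Q" by simp
  show "\<forall>i\<le>n. 0 \<le> beta_coeff n i a"
    using assms by (simp add: beta_coeff_nonneg)
qed

end
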